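(* The group $ESL_2(\mathbb{Z})$ does not possess a generating set of involutions of type $(2\times2,2)$; that is, $ESL_2(\mathbb{Z})$ is not generated by three involutions two of which commute.
   Context: $ESL_2(\mathbb{Z})$ denotes the group of all $2\times2$ integer matrices with determinant $1$ or $-1$. An involution is an element of order $2$. *)

theory Defs
  imports
    "HOL-Analysis.Determinants"
    "HOL-Algebra.Generated_Groups"
    "HOL-Algebra.Multiplicative_Group"
begin

definition ESL2Z :: "(int^2^2) monoid" where
  "ESL2Z = \<lparr>carrier = {A. det A = 1 \<or> det A = -1}, mult = (**), one = mat 1\<rparr>"

lemma group_ESL2Z: "group ESL2Z"
proof (rule groupI)
  fix A :: "int^2^2"
  assume "A \<in> carrier ESL2Z"
  then have d: "det A = 1 \<or> det A = -1" by (simp add: ESL2Z_def)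
  define B :: "int^2^2" where
    "B = (\<chi> i j. det A * (if i = 1 then (if j = 1 then A$2$2 else - A$1$2)
                                   else (if j = 1 then - A$2$1 else A$1$1)))"
  have dd: "det A * det A = 1" using d by auto
  have "det B = det A * det A * det A"
    unfolding det_2[of B] by (simp add: B_def) (simp add: det_2 algebra_simps)
  with d have B: "B \<in> carrier ESL2Z" by (auto simp: ESL2Z_def)
  have "(B ** A) $ i $ j = (if i = j then det A * det A else 0)" for i j
    using exhaust_2[of i] exhaust_2[of j]
    by (auto simp: B_def matrix_matrix_mult_def sum_2) (simp_all add: det_2 algebra_simps)
  then have "B ** A = mat 1"
    by (simp add: dd vec_eq_iff mat_def)
  with B show "\<exists>B\<in>carrier ESL2Z. B \<otimes>\<^bsub>ESL2Z\<^esub> A = \<one>\<^bsub>ESL2Z\<^esub>"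
    by (auto simp: ESL2Z_def)
qed (auto simp: ESL2Z_def det_mul matrix_mul_assoc)

definition involution :: "('a, 'b) monoid_scheme \<Rightarrow> 'a \<Rightarrow> bool" where
  "involution G x \<longleftrightarrow> x \<in> carrier G \<and> group.ord G x = 2"

(* The generators are not required to be pairwise distinct. *)
definition generated_by_involutions_2x2_2 :: "('a, 'b) monoid_scheme \<Rightarrow> bool" where
  "generated_by_involutions_2x2_2 G \<longleftrightarrow>
     (\<exists>a b c. involution G a \<and> involution G b \<and> involution G c \<and>
        a \<otimes>\<^bsub>G\<^esub> b = b \<otimes>\<^bsub>G\<^esub> a \<and> generate G {a, b, c} = carrier G)"

end

theory Submission
  imports Defs
begin

text \<open>
  An involution of determinant \<open>1\<close> is \<open>-1\<close>, so of two commuting involutions either one is central or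
  they differ by a central factor. Hence a generating set of type \<open>(2\<times>2,2)\<close> would consist, modulo
  the center, of two involutions \<open>p, q\<close> only. Every element of the group then centralizes or inverts
  \<open>p q\<close>, so every square centralizes \<open>p q\<close>. But the squares of the two elementary transvections
  have only scalars in their common centralizer, so \<open>p q\<close> is central; then \<open>p\<close> and \<open>q\<close> commute and
  the group is abelian, a contradiction.
\<close>

section \<open>Groups generated, modulo the center, by two elements of square one\<close>

context group
begin

definition central :: "'a \<Rightarrow> bool" where
  "central z \<longleftrightarrow> z \<in> carrier G \<and> (\<forall>g\<in>carrier G. z \<otimes> g = g \<otimes> z)"

lemma subgroup_commuting:
  assumes t: "t \<in> carrier G"
  shows "subgroup {g \<in> carrier G. t \<otimes> g = g \<otimes> t} G"
proof (rule subgroupI)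
  fix g assume "g \<in> {g \<in> carrier G. t \<otimes> g = g \<otimes> t}"
  then show "inv g \<in> {g \<in> carrier G. t \<otimes> g = g \<otimes> t}"
    using t by (auto simp: inv_solve_left inv_solve_right m_assoc)
                (metis inv_closed inv_solve_left m_assoc m_closed r_inv r_one)
next
  fix g h assume "g \<in> {g \<in> carrier G. t \<otimes> g = g \<otimes> t}" "h \<in> {g \<in> carrier G. t \<otimes> g = g \<otimes> t}"
  then show "g \<otimes> h \<in> {g \<in> carrier G. t \<otimes> g = g \<otimes> t}"
    using t by (auto simp flip: m_assoc) (metis m_assoc)
qed (use t in auto)

lemma central_if_commutes_generators:
  assumes t: "t \<in> carrier G" and S: "S \<subseteq> carrier G" "generate G S = carrier G"
    and comm: "\<And>s. s \<in> S \<Longrightarrow> t \<otimes> s = s \<otimes> t"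
  shows "central t"
  using generate_subgroup_incl[OF _ subgroup_commuting[OF t], of S] S comm t
  by (auto simp: central_def)

text \<open>The \<open>g\<close> satisfying this form the stabilizer of \<open>{t, inv t}\<close>
  under conjugation, which is a subgroup; so it suffices to test generators.\<close>

definition inverts_or_fixes :: "'a \<Rightarrow> 'a \<Rightarrow> bool" where
  "inverts_or_fixes t g \<longleftrightarrow> g \<otimes> t \<otimes> inv g = t \<or> g \<otimes> t \<otimes> inv g = inv t"

lemma conj_inv: "g \<in> carrier G \<Longrightarrow> t \<in> carrier G \<Longrightarrow> g \<otimes> inv t \<otimes> inv g = inv (g \<otimes> t \<otimes> inv g)"
  by (simp add: inv_mult_group m_assoc)

lemma conj_mult:
  "g \<in> carrier G \<Longrightarrow> h \<in> carrier G \<Longrightarrow> t \<in> carrier G \<Longrightarrow>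
    (g \<otimes> h) \<otimes> t \<otimes> inv (g \<otimes> h) = g \<otimes> (h \<otimes> t \<otimes> inv h) \<otimes> inv g"
  by (simp add: inv_mult_group m_assoc)

lemma inverts_or_fixes_mult:
  assumes "g \<in> carrier G" "h \<in> carrier G" "t \<in> carrier G"
    and "inverts_or_fixes t g" "inverts_or_fixes t h"
  shows "inverts_or_fixes t (g \<otimes> h)"
  using assms unfolding inverts_or_fixes_def conj_mult[OF assms(1-3)]
  by (auto simp: conj_inv)

lemma inverts_or_fixes_inv:
  assumes g: "g \<in> carrier G" and t: "t \<in> carrier G" and "inverts_or_fixes t g"
  shows "inverts_or_fixes t (inv g)"
proof -
  have "inv g \<otimes> (g \<otimes> t \<otimes> inv g) \<otimes> inv (inv g) = t"
    using conj_mult[of "inv g" g t] g t by simp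
  then show ?thesis
    using assms(3) conj_inv[of "inv g" t] g t
    unfolding inverts_or_fixes_def by (metis inv_closed inv_inv m_closed)
qed

lemma inverts_or_fixes_generate:
  assumes "S \<subseteq> carrier G" "t \<in> carrier G" "\<And>s. s \<in> S \<Longrightarrow> inverts_or_fixes t s"
    and "g \<in> generate G S"
  shows "inverts_or_fixes t g"
  using assms(4)
proof induction
  case one
  then show ?case using assms(2) by (simp add: inverts_or_fixes_def)
next
  case (incl h)
  then show ?case using assms by blast
next
  case (inv h)
  then show ?case using assms inverts_or_fixes_inv by blast
next
  case (eng h1 h2)
  then show ?case
    using inverts_or_fixes_mult generate_in_carrier[OF assms(1)] assms(2) by blast
qed

text \<open>Conjugation by \<open>g\<close> acts on \<open>{t, inv t}\<close> either trivially or by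
  inversion, and inverting twice gives back \<open>t\<close>.\<close>

lemma square_commutes_if_inverts_or_fixes:
  assumes g: "g \<in> carrier G" and t: "t \<in> carrier G" and inv: "inverts_or_fixes t g"
  shows "t \<otimes> (g \<otimes> g) = (g \<otimes> g) \<otimes> t"
proof -
  have "(g \<otimes> g) \<otimes> t \<otimes> inv (g \<otimes> g) = t"
    using inv conj_inv[OF g t] t unfolding conj_mult[OF g g t] inverts_or_fixes_def by auto
  then show ?thesis
    using g t by (metis inv_solve_right m_closed)
qed

text \<open>The element \<open>p \<otimes> q\<close> plays the rotation of a dihedral group:
  \<open>p\<close> and \<open>q\<close> both invert it, and \<open>a\<close> acts on it trivially or
  as \<open>p\<close> does. The assumption \<open>squares\<close> says that whatever centralizes all
  squares is central; it is the only input specific to the matrix group.\<close>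

lemma commutative_if_dihedral_mod_center:
  assumes p: "p \<in> carrier G" "p \<otimes> p = \<one>" and q: "q \<in> carrier G" "q \<otimes> q = \<one>"
    and a: "central a \<or> (\<exists>z. central z \<and> a = z \<otimes> p)"
    and gen: "generate G {a, p, q} = carrier G"
    and squares: "\<And>t. t \<in> carrier G \<Longrightarrow> (\<And>g. g \<in> carrier G \<Longrightarrow> t \<otimes> (g \<otimes> g) = (g \<otimes> g) \<otimes> t) \<Longrightarrow> central t"
    and x: "x \<in> carrier G" and y: "y \<in> carrier G"
  shows "x \<otimes> y = y \<otimes> x"
proof -
  define t where "t = p \<otimes> q"
  have a_carrier: "a \<in> carrier G" using a p by (auto simp: central_def)
  have t: "t \<in> carrier G" using p q by (simp add: t_def)
  have inv_p: "inv p = p" and inv_q: "inv q = q" using p q by (auto intro: inv_equality)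
  have inv_t: "inv t = q \<otimes> p" using p q by (simp add: t_def inv_mult_group inv_p inv_q)
  have central_fixes: "inverts_or_fixes t z" if "central z" for z
  proof -
    have "z \<otimes> t = t \<otimes> z" "z \<in> carrier G" using that t by (auto simp: central_def)
    then show ?thesis using t by (simp add: inverts_or_fixes_def m_assoc)
  qed
  have p_inverts: "inverts_or_fixes t p"
    unfolding inverts_or_fixes_def inv_t inv_p unfolding t_def
    using p q by (simp flip: m_assoc)
  have q_inverts: "inverts_or_fixes t q"
    unfolding inverts_or_fixes_def inv_t inv_q unfolding t_def
    using p q by (simp add: m_assoc)
  have a_inverts: "inverts_or_fixes t a"
    using a central_fixes inverts_or_fixes_mult[of _ p t] p t p_inverts by (auto simp: central_def)
  have "central t"
  proof (rule squares[OF t])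
    fix g assume g: "g \<in> carrier G"
    have "inverts_or_fixes t g"
      using inverts_or_fixes_generate[of "{a, p, q}" t g] g gen p q a_carrier t
        p_inverts q_inverts a_inverts by auto
    then show "t \<otimes> (g \<otimes> g) = (g \<otimes> g) \<otimes> t"
      using square_commutes_if_inverts_or_fixes g t by blast
  qed
  then have "p \<otimes> t = t \<otimes> p" using p by (simp add: central_def)
  \<comment> \<open>Cancelling \<open>p\<close> on the left of
    \<open>p \<otimes> (p \<otimes> q) = (p \<otimes> q) \<otimes> p\<close> leaves the
    claim.\<close>
  then have pq: "p \<otimes> q = q \<otimes> p"
    using p q unfolding t_def by (metis l_one m_assoc m_closed r_one)
  have ac: "a \<otimes> p = p \<otimes> a \<and> a \<otimes> q = q \<otimes> a"
    using a
  proof (elim disjE exE conjE)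
    fix z assume "central z" and a_eq: "a = z \<otimes> p"
    then have z: "z \<in> carrier G" "z \<otimes> p = p \<otimes> z" "z \<otimes> q = q \<otimes> z"
      using p q by (auto simp: central_def)
    have "z \<otimes> p \<otimes> p = p \<otimes> z \<otimes> p" using z(2) by simp
    then have "a \<otimes> p = p \<otimes> a" using z(1) p by (simp add: a_eq m_assoc)
    moreover have "z \<otimes> p \<otimes> q = z \<otimes> q \<otimes> p" using z(1) p q pq by (simp add: m_assoc)
    then have "a \<otimes> q = q \<otimes> a" unfolding z(3) using z(1) p q by (simp add: a_eq m_assoc)
    ultimately show ?thesis ..
  qed (use p q in \<open>auto simp: central_def\<close>)
  \<comment> \<open>Commuting with the generators is upgraded to centrality twice: first for each
    generator, then for the arbitrary element \<open>x\<close>.\<close>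
  have "central s" if "s \<in> {a, p, q}" for s
    by (rule central_if_commutes_generators[OF _ _ gen])
       (use that p q pq ac a_carrier in auto)
  then have "x \<otimes> s = s \<otimes> x" if "s \<in> {a, p, q}" for s
    using that x unfolding central_def by metis
  then have "central x"
    using p q a_carrier by (intro central_if_commutes_generators[OF x _ gen]) auto
  then show ?thesis using y by (simp add: central_def)
qed

end

section \<open>Integer matrices of size two\<close>

lemma vec2_eq_iff:
  "(A :: 'a^2^2) = B \<longleftrightarrow> A$1$1 = B$1$1 \<and> A$1$2 = B$1$2 \<and> A$2$1 = B$2$1 \<and> A$2$2 = B$2$2"
  by (auto simp: vec_eq_iff forall_2)

lemma matrix_mul_2:
  fixes A B :: "'a::comm_ring_1^2^2"
  shows "(A ** B) $ i $ j = A$i$1 * B$1$j + A$i$2 * B$2$j"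
  by (simp add: matrix_matrix_mult_def sum_2)

lemma mat_nth_2:
  "(mat k :: 'a::comm_ring_1^2^2)$1$1 = k" "(mat k :: 'a^2^2)$1$2 = 0"
  "(mat k :: 'a^2^2)$2$1 = 0" "(mat k :: 'a^2^2)$2$2 = k"
  by (simp_all add: mat_def)

text \<open>By Cayley-Hamilton, a matrix of determinant one and square one satisfies
  \<open>tr A * A = 2\<close>. Hence its trace is nonzero and it is a scalar, whose square is
  one.\<close>

lemma square_one_det_one:
  fixes A :: "int^2^2"
  assumes "A ** A = mat 1" "det A = 1"
  shows "A = mat 1 \<or> A = mat (-1)"
proof -
  define a b c d where abcd: "a = A$1$1" "b = A$1$2" "c = A$2$1" "d = A$2$2"
  have sq: "a * a + b * c = 1" "a * b + b * d = 0" "c * a + d * c = 0" "c * b + d * d = 1"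
    using assms(1) by (auto simp: vec2_eq_iff matrix_mul_2 mat_nth_2 abcd)
  have det: "a * d - b * c = 1" using assms(2) by (simp add: det_2 abcd)
  \<comment> \<open>These are the four entries of the Cayley-Hamilton identity.\<close>
  have "(a + d) * a = 2" "(a + d) * d = 2" "b * (a + d) = 0" "c * (a + d) = 0"
    using sq det by (auto simp: algebra_simps)
  then have "a + d \<noteq> 0" "(a + d) * a = (a + d) * d" "b = 0" "c = 0" by auto
  then have bcd: "b = 0" "c = 0" "a = d" using mult_left_cancel by blast+
  with det have "a * a = 1" by simp
  then have "a = 1 \<or> a = -1" by (simp add: square_eq_1_iff)
  with bcd show ?thesis by (auto simp: vec2_eq_iff mat_nth_2 abcd)
qed

definition upper_transvection :: "int^2^2" where
  "upper_transvection = (\<chi> i j. if i = 2 \<and> j = 1 then 0 else 1)"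

definition lower_transvection :: "int^2^2" where
  "lower_transvection = (\<chi> i j. if i = 1 \<and> j = 2 then 0 else 1)"

lemma transvection_nth:
  "upper_transvection$1$1 = 1" "upper_transvection$1$2 = 1"
  "upper_transvection$2$1 = 0" "upper_transvection$2$2 = 1"
  "lower_transvection$1$1 = 1" "lower_transvection$1$2 = 0"
  "lower_transvection$2$1 = 1" "lower_transvection$2$2 = 1"
  by (simp_all add: upper_transvection_def lower_transvection_def)

lemma transvections_in_carrier:
  "upper_transvection \<in> carrier ESL2Z" "lower_transvection \<in> carrier ESL2Z"
  by (simp_all add: ESL2Z_def det_2 transvection_nth)

lemma transvections_not_commute:
  "upper_transvection ** lower_transvection \<noteq> lower_transvection ** upper_transvection"
  by (simp add: vec2_eq_iff matrix_mul_2 transvection_nth)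

text \<open>The squares have off-diagonal entry 2, which cancels over the integers. The upper one
  forces \<open>T$2$1 = 0\<close> and equal diagonal entries, the lower one
  \<open>T$1$2 = 0\<close>.\<close>

lemma scalar_if_commutes_transvection_squares:
  fixes T :: "int^2^2"
  assumes "T ** (upper_transvection ** upper_transvection) = (upper_transvection ** upper_transvection) ** T"
    and "T ** (lower_transvection ** lower_transvection) = (lower_transvection ** lower_transvection) ** T"
  shows "T = mat (T$1$1)"
  using assms by (simp add: vec2_eq_iff matrix_mul_2 transvection_nth mat_nth_2)

lemma mat_commutes: "mat k ** A = A ** mat k" for A :: "int^2^2"
  by (simp add: vec2_eq_iff matrix_mul_2 mat_nth_2)

lemma central_mat: "mat k \<in> carrier ESL2Z \<Longrightarrow> group.central ESL2Z (mat k)"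
  using group.central_def[OF group_ESL2Z, of "mat k"] mat_commutes by (simp add: ESL2Z_def)

text \<open>A factor of determinant one is plus or minus the identity, hence central. If both
  determinants are -1, the product has determinant one and, by commutation, square one, so it is
  itself central.\<close>

lemma commuting_square_one_cases:
  fixes A B :: "int^2^2"
  assumes A: "A \<in> carrier ESL2Z" "A ** A = mat 1" and B: "B \<in> carrier ESL2Z" "B ** B = mat 1"
    and comm: "A ** B = B ** A"
  shows "group.central ESL2Z A \<or> group.central ESL2Z B \<or> (\<exists>Z. group.central ESL2Z Z \<and> A = Z ** B)"
proof -
  have unit: "group.central ESL2Z (mat 1)" "group.central ESL2Z (mat (-1))"
    by (rule central_mat; simp add: ESL2Z_def det_2 mat_nth_2)+
  consider "det A = 1" | "det B = 1" | "det A = -1" "det B = -1"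
    using A B by (auto simp: ESL2Z_def)
  then show ?thesis
  proof cases
    case 1
    then show ?thesis using square_one_det_one A unit by metis
  next
    case 2
    then show ?thesis using square_one_det_one B unit by metis
  next
    case 3
    have "(A ** B) ** (A ** B) = A ** (A ** B) ** B"
      using comm by (metis matrix_mul_assoc)
    also have "\<dots> = mat 1"
      using A B by (metis matrix_mul_assoc matrix_mul_lid)
    finally have "A ** B = mat 1 \<or> A ** B = mat (-1)"
      using square_one_det_one 3 by (simp add: det_mul)
    \<comment> \<open>The central factor \<open>Z\<close> is \<open>A ** B\<close>, because
      \<open>B\<close> is its own inverse.\<close>
    moreover have "A = (A ** B) ** B"
      using B by (metis matrix_mul_assoc matrix_mul_rid)
    ultimately show ?thesis using unit by metis
  qed
qed

theorem proposition3:
  shows "\<not> generated_by_involutions_2x2_2 ESL2Z"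
proof
  interpret G: group ESL2Z by (rule group_ESL2Z)
  have mult: "x \<otimes>\<^bsub>ESL2Z\<^esub> y = x ** y" and one: "\<one>\<^bsub>ESL2Z\<^esub> = mat 1" for x y
    by (simp_all add: ESL2Z_def)
  \<comment> \<open>Testing \<open>T\<close> against the squares of the two transvections already
    makes it scalar.\<close>
  have squares: "G.central T"
    if "T \<in> carrier ESL2Z" and "\<And>g. g \<in> carrier ESL2Z \<Longrightarrow> T ** (g ** g) = (g ** g) ** T" for T
    using that scalar_if_commutes_transvection_squares[of T] transvections_in_carrier central_mat
    by metis
  have involution: "x \<in> carrier ESL2Z \<and> x ** x = mat 1" if "involution ESL2Z x" for x
    using that G.pow_ord_eq_1[of x] by (simp add: involution_def numeral_2_eq_2 mult one)
  \<comment> \<open>Such generators would make the two transvections commute.\<close>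
  have not_gen: False
    if "p \<in> carrier ESL2Z" "p ** p = mat 1" "q \<in> carrier ESL2Z" "q ** q = mat 1"
      "G.central a \<or> (\<exists>z. G.central z \<and> a = z ** p)" "generate ESL2Z {a, p, q} = carrier ESL2Z"
    for a p q
    using G.commutative_if_dihedral_mod_center[of p q a, unfolded mult one, OF that squares
        transvections_in_carrier] transvections_not_commute by blast
  assume "generated_by_involutions_2x2_2 ESL2Z"
  then obtain a b c where inv: "involution ESL2Z a" "involution ESL2Z b" "involution ESL2Z c"
    and comm: "a ** b = b ** a" and gen: "generate ESL2Z {a, b, c} = carrier ESL2Z"
    by (auto simp: generated_by_involutions_2x2_2_def mult)
  consider "G.central a \<or> (\<exists>z. G.central z \<and> a = z ** b)" | "G.central b"
    using commuting_square_one_cases[of a b] involution inv comm by blast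
  then show False
  proof cases
    case 1
    then show ?thesis using not_gen[of b c a] involution inv gen by blast
  next
    \<comment> \<open>With \<open>b\<close> central, the roles of \<open>a\<close> and
      \<open>b\<close> are exchanged: \<open>a\<close> and \<open>c\<close> are now the two
      involutions generating modulo the center.\<close>
    case 2
    then show ?thesis using not_gen[of a c b] involution inv gen by (simp add: insert_commute)
  qed
qed

end
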